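(* Let $R$ be an associative ring with unity, $a\in R$ and $n\in\mathbb{N}$. The following are equivalent: (1) $a$ is $pns$-Drazin invertible. (2) There exists a unique $e\in R$ with $e^2=e\in\mathrm{comm}(a)$ such that $a^n-e\in\sqrt{J(R)}$. (3) There exists a unique $y\in R$ such that $ya=ay$, $y=yay$ and $a^n-ay\in\sqrt{J(R)}$. (4) $a$ is $p$-Drazin invertible and $a-a^{n+1}\in\sqrt{J(R)}$.
   Context: $\mathbb{N}$ is the set of positive integers. For a ring $R$, $J(R)$ is the Jacobson radical and $\sqrt{J(R)}=\{x\in R: x^k\in J(R)\text{ for some }k\ge 1\}$. For $x\in R$: $\mathrm{comm}(x)=\{y\in R: xy=yx\}$ and $\mathrm{comm}^2(x)=\{y\in R: yz=zy\text{ for all }z\in\mathrm{comm}(x)\}$. For fixed $n\in\mathbb{N}$, $a\in R$ is $pns$-Drazin invertible (pseudo $n$-strong Drazin invertible) if there exists $x\in R$ with $xax=x$, $x\in\mathrm{comm}^2(a)$ and $a^n-ax\in\sqrt{J(R)}$. An element $a\in R$ is $p$-Drazin invertible (pseudo Drazin invertible) if there exists $x\in R$ with $xax=x$, $x\in\mathrm{comm}^2(a)$ and $a-a^2x\in\sqrt{J(R)}$. *)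

theory Defs
  imports Main
begin

text \<open>
  Rings with unity are types of sort \<open>{ring, monoid_mult}\<close> rather than of class
  \<open>ring_1\<close>: the latter imposes \<open>0 \<noteq> 1\<close> and so excludes the zero ring.
\<close>

definition comm :: "'a::{ring, monoid_mult} \<Rightarrow> 'a set" where
  "comm x = {y. x * y = y * x}"

definition comm2 :: "'a::{ring, monoid_mult} \<Rightarrow> 'a set" where
  "comm2 x = {y. \<forall>z \<in> comm x. y * z = z * y}"

definition left_ideal :: "'a::{ring, monoid_mult} set \<Rightarrow> bool" where
  "left_ideal I \<longleftrightarrow>
     0 \<in> I \<and> (\<forall>x \<in> I. \<forall>y \<in> I. x + y \<in> I) \<and> (\<forall>r. \<forall>x \<in> I. r * x \<in> I)"

definition maximal_left_ideal :: "'a::{ring, monoid_mult} set \<Rightarrow> bool" where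
  "maximal_left_ideal M \<longleftrightarrow>
     left_ideal M \<and> M \<noteq> UNIV \<and>
     (\<forall>I. left_ideal I \<longrightarrow> M \<subseteq> I \<longrightarrow> I = M \<or> I = UNIV)"

text \<open>In the zero ring there is no maximal left ideal, and the intersection is the whole ring.\<close>

definition jacobson_radical :: "'a::{ring, monoid_mult} set" where
  "jacobson_radical = \<Inter> {M. maximal_left_ideal M}"

definition sqrt_jacobson :: "'a::{ring, monoid_mult} set" where
  "sqrt_jacobson = {x. \<exists>k\<ge>1. x ^ k \<in> jacobson_radical}"

definition pns_Drazin_invertible :: "nat \<Rightarrow> 'a::{ring, monoid_mult} \<Rightarrow> bool" where
  "pns_Drazin_invertible n a \<longleftrightarrow>
     (\<exists>x. x * a * x = x \<and> x \<in> comm2 a \<and> a ^ n - a * x \<in> sqrt_jacobson)"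

definition p_Drazin_invertible :: "'a::{ring, monoid_mult} \<Rightarrow> bool" where
  "p_Drazin_invertible a \<longleftrightarrow>
     (\<exists>x. x * a * x = x \<and> x \<in> comm2 a \<and> a - a ^ 2 * x \<in> sqrt_jacobson)"

end

theory Submission
  imports Defs
begin

text \<open>
  If \<open>e\<close> is an idempotent commuting with \<open>a\<close> and \<open>w = a ^ n - e\<close> is nilpotent modulo the radical
  \<open>J\<close>, then \<open>1 + w\<close> is a unit and \<open>y = a ^ (n - 1) * e * (1 + w)\<inverse>\<close> satisfies \<open>a * y = e\<close> and
  \<open>y * a * y = y\<close>; so the idempotents of (2) and the elements of (3) correspond bijectively.
  For \<open>z\<close> commuting with \<open>a\<close>, the corners \<open>e * z * (1 - e)\<close> and \<open>(1 - e) * z * e\<close> lie in \<open>J\<close>, so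
  adding either of them to \<open>e\<close> gives another idempotent satisfying (2). Hence uniqueness in (2)
  forces \<open>e\<close>, and with it \<open>y\<close>, into the double commutant. Conversely, if \<open>e\<close> is in the double
  commutant, it commutes with any competitor \<open>f\<close>; then \<open>e - f\<close> is nilpotent modulo \<open>J\<close> and
  \<open>(e - f) ^ 3 = e - f\<close>, so \<open>e - f = 0\<close> because \<open>J\<close> contains no nonzero idempotent.
\<close>

section \<open>The Jacobson radical\<close>

lemma left_idealD:
  assumes "left_ideal I"
  shows "0 \<in> I" and "x \<in> I \<Longrightarrow> y \<in> I \<Longrightarrow> x + y \<in> I" and "x \<in> I \<Longrightarrow> r * x \<in> I"
  using assms by (auto simp: left_ideal_def)

lemma left_ideal_eq_UNIV_iff:
  assumes "left_ideal I"
  shows "I = UNIV \<longleftrightarrow> 1 \<in> I"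
  using left_idealD(3)[OF assms, of 1] by (metis UNIV_I UNIV_eq_I mult_1_right)

text \<open>Zorn's lemma applies because properness of a left ideal means that \<open>1\<close> is
  absent, and this property survives the union of a nonempty chain.\<close>

lemma maximal_left_ideal_extension:
  fixes I :: "'a::{ring, monoid_mult} set"
  assumes I: "left_ideal I" and "1 \<notin> I"
  shows "\<exists>M. maximal_left_ideal M \<and> I \<subseteq> M"
proof -
  define A where "A = {K. left_ideal K \<and> 1 \<notin> K \<and> I \<subseteq> K}"
  have "\<exists>M\<in>A. \<forall>X\<in>A. M \<subseteq> X \<longrightarrow> X = M"
  proof (rule subset_Zorn_nonempty)
    show "A \<noteq> {}" using assms by (auto simp: A_def)
  next
    fix C assume C: "C \<noteq> {}" "subset.chain A C"
    have sub: "left_ideal K" "1 \<notin> K" "I \<subseteq> K" if "K \<in> C" for K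
      using C(2) that by (auto simp: subset_chain_def A_def)
    have chain: "K \<subseteq> L \<or> L \<subseteq> K" if "K \<in> C" "L \<in> C" for K L
      using C(2) that by (auto simp: subset_chain_def)
    have "left_ideal (\<Union>C)"
      unfolding left_ideal_def
    proof (intro conjI ballI allI)
      show "0 \<in> \<Union>C" using C(1) left_idealD(1)[OF sub(1)] by blast
    next
      fix x y assume "x \<in> \<Union>C" "y \<in> \<Union>C"
      then obtain K where "K \<in> C" "x \<in> K" "y \<in> K" using chain by blast
      then show "x + y \<in> \<Union>C" using left_idealD(2)[OF sub(1)] by blast
    next
      fix r x assume "x \<in> \<Union>C"
      then show "r * x \<in> \<Union>C" using left_idealD(3)[OF sub(1)] by blast
    qed
    then show "\<Union>C \<in> A" unfolding A_def using C(1) sub(2,3) by blast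
  qed
  then obtain M where M: "M \<in> A" and max: "\<And>X. X \<in> A \<Longrightarrow> M \<subseteq> X \<Longrightarrow> X = M" by blast
  have "maximal_left_ideal M"
    unfolding maximal_left_ideal_def
  proof (intro conjI allI impI)
    show "left_ideal M" "M \<noteq> UNIV" using M by (auto simp: A_def)
  next
    fix K assume "left_ideal K" "M \<subseteq> K"
    then show "K = M \<or> K = UNIV"
      using M max[of K] left_ideal_eq_UNIV_iff[of K] by (auto simp: A_def)
  qed
  then show ?thesis using M by (auto simp: A_def)
qed

section \<open>The radical as a two-sided ideal; quasi-regularity of its elements\<close>

lemma jacobson_radical_left_ideal: "left_ideal jacobson_radical"
  by (auto simp: jacobson_radical_def maximal_left_ideal_def left_ideal_def)

lemmas jacobson_radical_0 = left_idealD(1)[OF jacobson_radical_left_ideal]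
lemmas jacobson_radical_add = left_idealD(2)[OF jacobson_radical_left_ideal]
lemmas jacobson_radical_mult_left = left_idealD(3)[OF jacobson_radical_left_ideal]

text \<open>Otherwise the left ideal generated by \<open>1 - r\<close> is proper and lies in some
  maximal \<open>M\<close>; since \<open>r\<close> is in \<open>M\<close> as well, so is
  \<open>1\<close>.\<close>

lemma jacobson_radical_left_inverse:
  fixes r :: "'a::{ring, monoid_mult}"
  assumes "r \<in> jacobson_radical"
  shows "\<exists>v. v * (1 - r) = 1"
proof (rule ccontr)
  assume contra: "\<nexists>v. v * (1 - r) = 1"
  let ?I = "range (\<lambda>v. v * (1 - r))"
  have "left_ideal ?I"
    unfolding left_ideal_def
  proof (intro conjI ballI allI)
    show "0 \<in> ?I" by (rule range_eqI[of _ _ 0]) simp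
  next
    fix x y assume "x \<in> ?I" "y \<in> ?I"
    then obtain u v where "x = u * (1 - r)" "y = v * (1 - r)" by auto
    then have "x + y = (u + v) * (1 - r)" by (simp only: distrib_right)
    then show "x + y \<in> ?I" by (rule range_eqI)
  next
    fix s x assume "x \<in> ?I"
    then obtain u where "x = u * (1 - r)" by auto
    then have "s * x = (s * u) * (1 - r)" by (simp only: mult.assoc)
    then show "s * x \<in> ?I" by (rule range_eqI)
  qed
  moreover have "1 \<notin> ?I" using contra by (metis imageE)
  ultimately obtain M where M: "maximal_left_ideal M" "?I \<subseteq> M"
    using maximal_left_ideal_extension by blast
  have lM: "left_ideal M" using M(1) by (simp add: maximal_left_ideal_def)
  have "1 - r \<in> ?I" by (rule range_eqI[of _ _ 1]) simp
  then have "1 - r \<in> M" using M(2) by blast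
  moreover have "r \<in> M" using assms M(1) by (auto simp: jacobson_radical_def)
  ultimately have "1 - r + r \<in> M" using left_idealD(2)[OF lM] by blast
  then have "1 \<in> M" by simp
  then show False using M(1) left_ideal_eq_UNIV_iff[OF lM] by (simp add: maximal_left_ideal_def)
qed

text \<open>A maximal \<open>M\<close> missing \<open>r\<close> satisfies
  \<open>M + R r = R\<close>, so some \<open>1 - s * r\<close> lies in \<open>M\<close>; its left
  inverse then puts \<open>1\<close> into \<open>M\<close>.\<close>

lemma jacobson_radicalI:
  fixes r :: "'a::{ring, monoid_mult}"
  assumes inv: "\<And>s. \<exists>v. v * (1 - s * r) = 1"
  shows "r \<in> jacobson_radical"
  unfolding jacobson_radical_def
proof clarify
  fix M :: "'a set" assume M: "maximal_left_ideal M"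
  have lM: "left_ideal M" using M by (simp add: maximal_left_ideal_def)
  show "r \<in> M"
  proof (rule ccontr)
    assume "r \<notin> M"
    define I where "I = {m + s * r | m s. m \<in> M}"
    have I_I: "m + s * r \<in> I" if "m \<in> M" for m s using that by (auto simp: I_def)
    have I_E: "\<exists>m s. x = m + s * r \<and> m \<in> M" if "x \<in> I" for x using that by (auto simp: I_def)
    have lI: "left_ideal I"
      unfolding left_ideal_def
    proof (intro conjI ballI allI)
      show "0 \<in> I" using I_I[OF left_idealD(1)[OF lM], of 0] by simp
    next
      fix x y assume "x \<in> I" "y \<in> I"
      then obtain m s m' s' where xy: "x = m + s * r" "y = m' + s' * r" and m: "m \<in> M" "m' \<in> M"
        using I_E by meson
      have "x + y = (m + m') + (s + s') * r" using xy by (simp add: algebra_simps)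
      then show "x + y \<in> I" using I_I[OF left_idealD(2)[OF lM m]] by simp
    next
      fix t x assume "x \<in> I"
      then obtain m s where x: "x = m + s * r" and m: "m \<in> M" using I_E by meson
      have "t * x = t * m + (t * s) * r" using x by (simp add: algebra_simps)
      then show "t * x \<in> I" using I_I[OF left_idealD(3)[OF lM m]] by simp
    qed
    have MI: "M \<subseteq> I"
    proof
      fix m assume "m \<in> M"
      then show "m \<in> I" using I_I[of m 0] by simp
    qed
    have "r \<in> I" using I_I[OF left_idealD(1)[OF lM], of 1] by simp
    then have "I = UNIV"
      using M lI MI \<open>r \<notin> M\<close> unfolding maximal_left_ideal_def by blast
    then obtain m s where ms: "1 = m + s * r" "m \<in> M" using I_E by blast
    then have "1 - s * r = m" by (metis add_diff_cancel_right')
    then obtain v where "v * m = 1" using inv by metis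
    then have "1 \<in> M" using left_idealD(3)[OF lM ms(2)] by metis
    then show False
      using M left_ideal_eq_UNIV_iff[OF lM] by (simp add: maximal_left_ideal_def)
  qed
qed

lemma jacobson_radical_mult_right:
  fixes r t :: "'a::{ring, monoid_mult}"
  assumes "r \<in> jacobson_radical"
  shows "r * t \<in> jacobson_radical"
proof (rule jacobson_radicalI)
  fix s
  have "t * s * r \<in> jacobson_radical" using assms by (rule jacobson_radical_mult_left)
  then obtain v where v: "v * (1 - t * s * r) = 1" using jacobson_radical_left_inverse by blast
  \<comment> \<open>Jacobson's lemma: a left inverse \<open>v\<close> of \<open>1 - y * x\<close>
    yields the left inverse \<open>1 + x * v * y\<close> of \<open>1 - x * y\<close>, here with
    \<open>x = s * r\<close> and \<open>y = t\<close>.\<close>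
  have "(1 + s * r * v * t) * (1 - s * (r * t)) =
      1 - s * r * t + s * r * (v * (1 - t * s * r)) * t"
    by (simp add: algebra_simps)
  also have "\<dots> = 1" unfolding v by simp
  finally show "\<exists>v. v * (1 - s * (r * t)) = 1" by blast
qed

lemma jacobson_radical_diff:
  fixes x y :: "'a::{ring, monoid_mult}"
  assumes "x \<in> jacobson_radical" "y \<in> jacobson_radical"
  shows "x - y \<in> jacobson_radical"
  using jacobson_radical_add[OF assms(1) jacobson_radical_mult_left[OF assms(2), of "- 1"]] by simp

text \<open>The left inverse \<open>v = 1 + v * r\<close> again differs from \<open>1\<close> by a
  radical element, so it has a left inverse too. Having \<open>1 - r\<close> as right inverse,
  \<open>v\<close> is a unit with inverse \<open>1 - r\<close>.\<close>

lemma one_minus_jacobson_radical_unit: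
  fixes r :: "'a::{ring, monoid_mult}"
  assumes r: "r \<in> jacobson_radical"
  shows "\<exists>v. v * (1 - r) = 1 \<and> (1 - r) * v = 1"
proof -
  obtain v where v: "v * (1 - r) = 1" using jacobson_radical_left_inverse[OF r] by blast
  then have v1: "v = 1 - (- v) * r" by (simp add: algebra_simps)
  moreover obtain t where "t * (1 - (- v) * r) = 1"
    using jacobson_radical_left_inverse[OF jacobson_radical_mult_left[OF r]] by blast
  ultimately have "t * v = 1" by metis
  then have "t = 1 - r" using v by (metis mult.assoc mult_1_left mult_1_right)
  then show ?thesis using v \<open>t * v = 1\<close> by blast
qed

text \<open>The left invertible element \<open>1 - g\<close> annihilates \<open>g\<close>.\<close>

lemma idempotent_jacobson_radical_0:
  fixes g :: "'a::{ring, monoid_mult}"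
  assumes "g \<in> jacobson_radical" "g * g = g"
  shows "g = 0"
proof -
  obtain v where v: "v * (1 - g) = 1" using jacobson_radical_left_inverse[OF assms(1)] by blast
  have "g = v * (1 - g) * g" using v by simp
  also have "\<dots> = v * (g - g * g)" by (simp add: algebra_simps)
  finally show ?thesis using assms(2) by simp
qed

section \<open>Elements nilpotent modulo the radical\<close>

lemma power_mult_commuting:
  fixes x y :: "'a::monoid_mult"
  assumes "x * y = y * x"
  shows "(x * y) ^ k = x ^ k * y ^ k"
proof (induction k)
  case (Suc k)
  have "(x * y) ^ Suc k = x * (y * x ^ k) * y ^ k" using Suc by (simp add: mult.assoc)
  also have "y * x ^ k = x ^ k * y" using power_commuting_commutes[OF assms] by simp
  finally show ?case by (simp add: mult.assoc)
qed simp

lemma idempotent_power: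
  fixes e :: "'a::monoid_mult"
  assumes "e * e = e" "k \<ge> 1"
  shows "e ^ k = e"
  using assms(2) by (induction rule: dec_induct) (simp_all add: assms(1))

lemma sqrt_jacobsonI: "k \<ge> 1 \<Longrightarrow> x ^ k \<in> jacobson_radical \<Longrightarrow> x \<in> sqrt_jacobson"
  by (auto simp: sqrt_jacobson_def)

lemma sqrt_jacobsonE:
  assumes "x \<in> sqrt_jacobson"
  obtains k where "k \<ge> 1" "x ^ k \<in> jacobson_radical"
  using assms by (auto simp: sqrt_jacobson_def)

lemma jacobson_radical_power_mono:
  fixes x :: "'a::{ring, monoid_mult}"
  assumes "x ^ k \<in> jacobson_radical" "k \<le> m"
  shows "x ^ m \<in> jacobson_radical"
  using jacobson_radical_mult_left[OF assms(1), of "x ^ (m - k)"] assms(2)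
  by (simp add: power_add[symmetric])

lemma sqrt_jacobson_mult_left:
  fixes c x :: "'a::{ring, monoid_mult}"
  assumes "x \<in> sqrt_jacobson" "c * x = x * c"
  shows "c * x \<in> sqrt_jacobson"
proof -
  obtain k where k: "k \<ge> 1" "x ^ k \<in> jacobson_radical" using assms(1) by (rule sqrt_jacobsonE)
  have "(c * x) ^ k \<in> jacobson_radical"
    unfolding power_mult_commuting[OF assms(2)] using k(2) by (rule jacobson_radical_mult_left)
  with k(1) show ?thesis by (rule sqrt_jacobsonI)
qed

lemma sqrt_jacobson_power_cancel:
  fixes x :: "'a::{ring, monoid_mult}"
  assumes "x ^ n \<in> sqrt_jacobson" "n \<ge> 1"
  shows "x \<in> sqrt_jacobson"
proof -
  obtain k where "k \<ge> 1" "(x ^ n) ^ k \<in> jacobson_radical" using assms(1) by (rule sqrt_jacobsonE)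
  then show ?thesis using assms(2) by (intro sqrt_jacobsonI[of "n * k"]) (auto simp: power_mult)
qed

lemma sqrt_jacobson_add:
  fixes p q :: "'a::{ring, monoid_mult}"
  assumes "p \<in> sqrt_jacobson" "q \<in> sqrt_jacobson" and pq: "p * q = q * p"
  shows "p + q \<in> sqrt_jacobson"
proof -
  obtain k where k: "k \<ge> 1" "p ^ k \<in> jacobson_radical" using assms(1) by (rule sqrt_jacobsonE)
  obtain l where l: "l \<ge> 1" "q ^ l \<in> jacobson_radical" using assms(2) by (rule sqrt_jacobsonE)
  \<comment> \<open>Instead of a binomial expansion, factors \<open>p + q\<close> are absorbed one
    at a time into \<open>p ^ i * q ^ j\<close>. Once none is left, \<open>i + j \<ge> k + l\<close>
    forces \<open>i \<ge> k\<close> or \<open>j \<ge> l\<close>.\<close>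
  have "p ^ i * q ^ j * (p + q) ^ m \<in> jacobson_radical" if "k + l \<le> i + j + m" for i j m
    using that
  proof (induction m arbitrary: i j)
    case 0
    then consider "k \<le> i" | "l \<le> j" by linarith
    then show ?case
      using jacobson_radical_power_mono[OF k(2)] jacobson_radical_power_mono[OF l(2)]
      by cases (auto intro: jacobson_radical_mult_left jacobson_radical_mult_right)
  next
    case (Suc m)
    have "q ^ j * p = p * q ^ j" using power_commuting_commutes[OF pq[symmetric]] .
    then have "p ^ i * q ^ j * p = p ^ Suc i * q ^ j"
      by (simp add: mult.assoc power_Suc2 del: power_Suc)
    moreover have "p ^ i * q ^ j * q = p ^ i * q ^ Suc j"
      by (simp add: mult.assoc power_Suc2 del: power_Suc)
    moreover have "p ^ i * q ^ j * (p + q) ^ Suc m =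
        p ^ i * q ^ j * p * (p + q) ^ m + p ^ i * q ^ j * q * (p + q) ^ m"
      by (simp add: distrib_left distrib_right mult.assoc)
    ultimately show ?case
      using Suc.IH[of "Suc i" j] Suc.IH[of i "Suc j"] Suc.prems
      by (simp add: jacobson_radical_add del: power_Suc)
  qed
  from this[of 0 0 "k + l"] have "(p + q) ^ (k + l) \<in> jacobson_radical" by simp
  then show ?thesis using k(1) by (intro sqrt_jacobsonI[of "k + l"]) auto
qed

lemma sqrt_jacobson_uminus:
  fixes x :: "'a::{ring, monoid_mult}"
  assumes "x \<in> sqrt_jacobson"
  shows "- x \<in> sqrt_jacobson"
  using sqrt_jacobson_mult_left[OF assms, of "- 1"] by simp

lemma sqrt_jacobson_diff:
  fixes p q :: "'a::{ring, monoid_mult}"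
  assumes "p \<in> sqrt_jacobson" "q \<in> sqrt_jacobson" "p * q = q * p"
  shows "p - q \<in> sqrt_jacobson"
  using sqrt_jacobson_add[OF assms(1) sqrt_jacobson_uminus[OF assms(2)]] assms(3) by simp

text \<open>The radical is two-sided, so congruence modulo it is compatible with products and hence
  with powers.\<close>

lemma jacobson_radical_power_diff:
  fixes x y :: "'a::{ring, monoid_mult}"
  assumes "x - y \<in> jacobson_radical"
  shows "x ^ k - y ^ k \<in> jacobson_radical"
proof (induction k)
  case 0
  show ?case by (simp add: jacobson_radical_0)
next
  case (Suc k)
  have "x ^ Suc k - y ^ Suc k = x * (x ^ k - y ^ k) + (x - y) * y ^ k"
    by (simp add: algebra_simps)
  then show ?case
    using jacobson_radical_add[OF jacobson_radical_mult_left[OF Suc]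
        jacobson_radical_mult_right[OF assms]] by metis
qed

text \<open>Nilpotence modulo the radical depends only on the residue class. This serves for
  perturbing an idempotent by a corner, which need not commute with it.\<close>

lemma sqrt_jacobson_diff_radical:
  fixes x j :: "'a::{ring, monoid_mult}"
  assumes "x \<in> sqrt_jacobson" "j \<in> jacobson_radical"
  shows "x - j \<in> sqrt_jacobson"
proof -
  obtain k where k: "k \<ge> 1" "x ^ k \<in> jacobson_radical" using assms(1) by (rule sqrt_jacobsonE)
  have "x ^ k - (x - j) ^ k \<in> jacobson_radical"
    by (rule jacobson_radical_power_diff) (simp add: assms(2))
  from jacobson_radical_diff[OF k(2) this] have "(x - j) ^ k \<in> jacobson_radical" by simp
  then show ?thesis using k(1) by (rule sqrt_jacobsonI[rotated])
qed

text \<open>The factor is the geometric sum of \<open>q ^ i\<close> for \<open>i < k\<close>, empty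
  when \<open>k = 0\<close>.\<close>

lemma one_minus_power_factor:
  fixes q :: "'a::{ring, monoid_mult}"
  shows "\<exists>s. s * (1 - q) = 1 - q ^ k \<and> (1 - q) * s = 1 - q ^ k"
proof (induction k)
  case 0
  show ?case by (rule exI[of _ 0]) simp
next
  case (Suc k)
  then obtain s where "s * (1 - q) = 1 - q ^ k" "(1 - q) * s = 1 - q ^ k" by blast
  then have "(s + q ^ k) * (1 - q) = 1 - q ^ Suc k" "(1 - q) * (s + q ^ k) = 1 - q ^ Suc k"
    by (simp_all add: distrib_left[of "1 - q"] distrib_right[of _ _ "1 - q"])
       (simp_all add: algebra_simps power_commutes)
  then show ?case by blast
qed

text \<open>By the geometric sum for \<open>- w\<close>, \<open>1 + w\<close> divides
  \<open>1 - (- w) ^ k\<close> on both sides, and the latter is a unit once \<open>(- w) ^ k\<close>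
  lies in the radical. The resulting left and right inverses must coincide.\<close>

lemma one_plus_sqrt_jacobson_unit:
  fixes w :: "'a::{ring, monoid_mult}"
  assumes "w \<in> sqrt_jacobson"
  shows "\<exists>v. v * (1 + w) = 1 \<and> (1 + w) * v = 1"
proof -
  obtain k where k: "(- w) ^ k \<in> jacobson_radical"
    using sqrt_jacobson_uminus[OF assms] by (rule sqrt_jacobsonE)
  obtain s where s: "s * (1 + w) = 1 - (- w) ^ k" "(1 + w) * s = 1 - (- w) ^ k"
    using one_minus_power_factor[of "- w" k] by auto
  obtain u where u: "u * (1 - (- w) ^ k) = 1" "(1 - (- w) ^ k) * u = 1"
    using one_minus_jacobson_radical_unit[OF k] by blast
  have left: "(u * s) * (1 + w) = 1" using s u by (simp add: mult.assoc)
  have right: "(1 + w) * (s * u) = 1" using s u by (simp add: mult.assoc[symmetric])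
  have "u * s = s * u" using left right by (metis mult.assoc mult_1_left mult_1_right)
  then show ?thesis using left right by metis
qed

lemma inverse_commutes:
  fixes u v z :: "'a::monoid_mult"
  assumes "v * u = 1" "u * v = 1" "u * z = z * u"
  shows "v * z = z * v"
  by (metis assms mult.assoc mult_1_left mult_1_right)

lemma commuting_idempotents_eq:
  fixes e f :: "'a::{ring, monoid_mult}"
  assumes e: "e * e = e" and f: "f * f = f" and ef: "e * f = f * e"
    and "e - f \<in> sqrt_jacobson"
  shows "e = f"
proof -
  define d where "d = e - f"
  have eff: "e * (e * f) = e * f" "f * (e * f) = e * f" "e * (f * e) = e * f"
    by (metis e f ef mult.assoc)+
  have dd: "d * d = e + f - e * f - e * f"
    using e f ef by (simp add: d_def algebra_simps)
  have d3: "d * (d * d) = d"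
    unfolding dd using e f ef eff by (simp add: d_def algebra_simps)
  then have gg: "(d * d) * (d * d) = d * d" by (metis mult.assoc)
  obtain k where k: "k \<ge> 1" "d ^ k \<in> jacobson_radical"
    using assms(4) unfolding d_def by (rule sqrt_jacobsonE)
  \<comment> \<open>Since \<open>d * d\<close> is idempotent, the even power
    \<open>d ^ (2 * k)\<close> collapses to it, so \<open>d * d\<close> itself lies in the
    radical.\<close>
  have "d ^ k * d ^ k = (d * d) ^ k" by (simp add: power_mult_commuting)
  also have "\<dots> = d * d" using gg k(1) by (rule idempotent_power)
  finally have "d * d \<in> jacobson_radical" using jacobson_radical_mult_left[OF k(2)] by metis
  then have "d * d = 0" using gg by (rule idempotent_jacobson_radical_0)
  then show ?thesis using d3 by (simp add: d_def)
qed

section \<open>Spectral idempotents\<close>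

lemma commute_mult:
  fixes x y z :: "'a::semigroup_mult"
  assumes "x * z = z * x" "y * z = z * y"
  shows "x * y * z = z * (x * y)"
  by (metis assms mult.assoc)

lemma commute_diff:
  fixes x y z :: "'a::ring"
  assumes "x * z = z * x" "y * z = z * y"
  shows "(x - y) * z = z * (x - y)"
  using assms by (simp add: algebra_simps)

text \<open>\<open>y\<close> inverts \<open>a\<close> in the corner of \<open>e\<close> and vanishes
  on the complement. The final clause lets \<open>y\<close> inherit membership in the double
  commutant from \<open>e\<close>.\<close>

lemma spectral_inverse:
  fixes a e :: "'a::{ring, monoid_mult}"
  assumes n: "n \<ge> 1" and ee: "e * e = e" and ae: "a * e = e * a"
    and w: "a ^ n - e \<in> sqrt_jacobson"
  shows "\<exists>y. a * y = e \<and> y * a = a * y \<and> y = y * a * y \<and>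
    (\<forall>z. z * a = a * z \<longrightarrow> z * e = e * z \<longrightarrow> y * z = z * y)"
proof -
  let ?u = "1 + (a ^ n - e)"
  obtain v where v: "v * ?u = 1" "?u * v = 1" using one_plus_sqrt_jacobson_unit[OF w] by blast
  have ucomm: "?u * z = z * ?u" if "z * a = a * z" "z * e = e * z" for z
  proof -
    have "a ^ n * z = z * a ^ n" using power_commuting_commutes[OF that(1)[symmetric]] .
    then show ?thesis using that(2) by (simp add: algebra_simps)
  qed
  \<comment> \<open>Multiplied by \<open>e\<close>, the unit \<open>?u\<close> becomes
    \<open>a ^ n * e\<close>. Hence \<open>v\<close> inverts \<open>a ^ n\<close> in the corner of
    \<open>e\<close>, and \<open>a ^ (n - 1) * v\<close> inverts \<open>a\<close> there.\<close>
  define y where "y = a ^ (n - 1) * e * v"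
  have ycomm: "y * z = z * y" if z: "z * a = a * z" "z * e = e * z" for z
  proof -
    have "a ^ (n - 1) * z = z * a ^ (n - 1)" using power_commuting_commutes[OF z(1)[symmetric]] .
    moreover have "v * z = z * v" using inverse_commutes[OF v ucomm[OF z]] .
    ultimately show ?thesis unfolding y_def using z(2) by (intro commute_mult) simp_all
  qed
  have "a * y = a ^ n * e * v"
    using n by (simp add: y_def mult.assoc[symmetric] power_Suc[symmetric] del: power_Suc)
  also have "a ^ n * e = ?u * e" using ee by (simp add: algebra_simps)
  also have "?u * e = e * ?u" using ucomm[of e] ae by simp
  also have "e * ?u * v = e" using v(2) by (simp add: mult.assoc)
  finally have ay: "a * y = e" .
  have ya: "y * a = a * y" using ycomm[of a] ae by simp
  have ve: "v * e = e * v" using inverse_commutes[OF v ucomm[of e]] ae by simp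
  have "y * a * y = y * e" using ay by (simp add: mult.assoc)
  also have "\<dots> = y" by (simp add: y_def mult.assoc ve) (simp add: mult.assoc[symmetric] ee)
  finally show ?thesis using ay ya ycomm by metis
qed

text \<open>Multiplication by \<open>1 - e\<close> kills the \<open>e\<close> in
  \<open>a ^ n - e\<close>, so the \<open>n\<close>-th power of \<open>a * (1 - e)\<close> is a
  commuting multiple of that element.\<close>

lemma spectral_complement:
  fixes a e :: "'a::{ring, monoid_mult}"
  assumes n: "n \<ge> 1" and ee: "e * e = e" and ae: "a * e = e * a"
    and w: "a ^ n - e \<in> sqrt_jacobson"
  shows "a * (1 - e) \<in> sqrt_jacobson"
proof (rule sqrt_jacobson_power_cancel[OF _ n])
  have c: "a * (1 - e) = (1 - e) * a" using ae by (simp add: algebra_simps)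
  have ane: "a ^ n * e = e * a ^ n" using power_commuting_commutes[OF ae] .
  have "(a * (1 - e)) ^ n = a ^ n * (1 - e) ^ n" using c by (rule power_mult_commuting)
  also have "(1 - e) ^ n = 1 - e"
    using n by (intro idempotent_power) (simp_all add: algebra_simps ee)
  also have "a ^ n * (1 - e) = (1 - e) * (a ^ n - e)"
    using ee ane by (simp add: algebra_simps)
  finally have "(a * (1 - e)) ^ n = (1 - e) * (a ^ n - e)" .
  moreover have "(1 - e) * (a ^ n - e) = (a ^ n - e) * (1 - e)"
    using ane by (simp add: algebra_simps)
  ultimately show "(a * (1 - e)) ^ n \<in> sqrt_jacobson" using sqrt_jacobson_mult_left[OF w] by metis
qed

text \<open>A Fitting-type argument: \<open>a\<close> is invertible in the corner of
  \<open>e\<close> and nilpotent modulo the radical in that of \<open>1 - e\<close>. Writing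
  \<open>e\<close> as \<open>y ^ k * a ^ k\<close> or \<open>a ^ k * y ^ k\<close> and moving
  \<open>a ^ k\<close> past \<open>z\<close> produces the radical element
  \<open>a ^ k * (1 - e)\<close>.\<close>

lemma spectral_corners_radical:
  fixes a e z :: "'a::{ring, monoid_mult}"
  assumes n: "n \<ge> 1" and ee: "e * e = e" and ae: "a * e = e * a"
    and w: "a ^ n - e \<in> sqrt_jacobson" and z: "z * a = a * z"
  shows "e * z * (1 - e) \<in> jacobson_radical" and "(1 - e) * z * e \<in> jacobson_radical"
proof -
  obtain y where ay: "a * y = e" "y * a = a * y"
    using spectral_inverse[OF n ee ae w] by blast
  obtain k where k: "k \<ge> 1" "(a * (1 - e)) ^ k \<in> jacobson_radical"
    using spectral_complement[OF n ee ae w] by (rule sqrt_jacobsonE)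
  have c: "a * (1 - e) = (1 - e) * a" using ae by (simp add: algebra_simps)
  have "(1 - e) ^ k = 1 - e"
    using k(1) by (intro idempotent_power) (simp_all add: algebra_simps ee)
  then have J: "a ^ k * (1 - e) \<in> jacobson_radical"
    using k(2) power_mult_commuting[OF c, of k] by simp
  have c': "a ^ k * (1 - e) = (1 - e) * a ^ k" using power_commuting_commutes[OF c] .
  have zk: "a ^ k * z = z * a ^ k" using power_commuting_commutes[OF z[symmetric]] .
  have e1: "e = a ^ k * y ^ k"
    using idempotent_power[OF ee k(1)] power_mult_commuting[of a y k] ay by simp
  have e2: "e = y ^ k * a ^ k"
    using idempotent_power[OF ee k(1)] power_mult_commuting[of y a k] ay by simp
  have "e * z * (1 - e) = y ^ k * (a ^ k * z) * (1 - e)" by (subst e2) (simp add: mult.assoc)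
  also have "\<dots> = y ^ k * z * (a ^ k * (1 - e))" by (simp only: zk mult.assoc)
  finally show "e * z * (1 - e) \<in> jacobson_radical" using jacobson_radical_mult_left[OF J] by metis
  have "(1 - e) * z * e = (1 - e) * (z * a ^ k) * y ^ k"
    using e1 by (metis mult.assoc)
  also have "\<dots> = (a ^ k * (1 - e)) * (z * y ^ k)" unfolding c' zk[symmetric] by (simp add: mult.assoc)
  finally show "(1 - e) * z * e \<in> jacobson_radical" using jacobson_radical_mult_right[OF J] by metis
qed

lemma unique_spectral_idempotent_comm2:
  fixes a e z :: "'a::{ring, monoid_mult}"
  assumes n: "n \<ge> 1" and ee: "e * e = e" and ae: "a * e = e * a"
    and w: "a ^ n - e \<in> sqrt_jacobson"
    and unique: "\<And>f. f * f = f \<Longrightarrow> a * f = f * a \<Longrightarrow> a ^ n - f \<in> sqrt_jacobson \<Longrightarrow> f = e"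
    and z: "z * a = a * z"
  shows "z * e = e * z"
proof -
  \<comment> \<open>Intended for the two corners of \<open>z\<close>: such a \<open>j\<close> has
    \<open>j * j = 0\<close> and \<open>e * j + j * e = j\<close>, which makes \<open>e + j\<close>
    idempotent.\<close>
  have perturb: "j = 0"
    if J: "j \<in> jacobson_radical" and idem: "(e + j) * (e + j) = e + j" and aj: "a * j = j * a" for j
  proof -
    have "a ^ n - (e + j) \<in> sqrt_jacobson"
      using sqrt_jacobson_diff_radical[OF w J] by (simp add: diff_diff_eq)
    then have "e + j = e" using unique[OF idem] ae aj by (simp add: algebra_simps)
    then show ?thesis by simp
  qed
  have eex: "e * (e * x) = e * x" for x by (metis ee mult.assoc)
  have aex: "a * (e * x) = e * (a * x)" for x by (metis ae mult.assoc)
  have zax: "a * (z * x) = z * (a * x)" for x by (metis z mult.assoc)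
  have 1: "e * z * (1 - e) = 0"
    by (rule perturb[OF spectral_corners_radical(1)[OF n ee ae w z]])
       (simp_all add: algebra_simps ee eex aex zax ae z[symmetric])
  have 2: "(1 - e) * z * e = 0"
    by (rule perturb[OF spectral_corners_radical(2)[OF n ee ae w z]])
       (simp_all add: algebra_simps ee eex aex zax ae z[symmetric])
  have "z * e = e * z * e" using 2 by (simp add: left_diff_distrib)
  also have "\<dots> = e * z" using 1 by (simp add: right_diff_distrib)
  finally show ?thesis .
qed

section \<open>Equivalence of the four conditions\<close>

theorem theorem2p6:
  fixes a :: "'a::{ring, monoid_mult}" and n :: nat
  assumes "n \<ge> 1"
  shows "(pns_Drazin_invertible n a \<longleftrightarrow>
            (\<exists>!e. e ^ 2 = e \<and> e \<in> comm a \<and> a ^ n - e \<in> sqrt_jacobson))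
       \<and> (pns_Drazin_invertible n a \<longleftrightarrow>
            (\<exists>!y. y * a = a * y \<and> y = y * a * y \<and> a ^ n - a * y \<in> sqrt_jacobson))
       \<and> (pns_Drazin_invertible n a \<longleftrightarrow>
            p_Drazin_invertible a \<and> a - a ^ (n + 1) \<in> sqrt_jacobson)"
proof -
  note n = assms
  let ?P = "\<lambda>e. e * e = e \<and> a * e = e * a \<and> a ^ n - e \<in> sqrt_jacobson"
  let ?Q = "\<lambda>y. y * a = a * y \<and> y = y * a * y \<and> a ^ n - a * y \<in> sqrt_jacobson"
  have P_iff: "(e ^ 2 = e \<and> e \<in> comm a \<and> a ^ n - e \<in> sqrt_jacobson) \<longleftrightarrow> ?P e" for e
    by (simp add: power2_eq_square comm_def)
  have QP: "?P (a * y)" if "?Q y" for y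
    using that by (metis mult.assoc)
  have PQ: "\<exists>y. ?Q y \<and> a * y = e" if "?P e" for e
    using that spectral_inverse[OF n, of e a] by metis
  have comm2D: "x * z = z * x" if "x \<in> comm2 a" "a * z = z * a" for x z
    using that by (simp add: comm2_def comm_def)
  have regular: "x * a = a * x" "(a * x) * (a * x) = a * x" "a * (a * x) = (a * x) * a"
    if "x * a * x = x" "x \<in> comm2 a" for x
    using that comm2D[of x a] by (metis mult.assoc)+

  have one_two: "\<exists>!e. ?P e" if pns: "pns_Drazin_invertible n a"
  proof -
    obtain x where x: "x * a * x = x" "x \<in> comm2 a" "a ^ n - a * x \<in> sqrt_jacobson"
      using pns by (auto simp: pns_Drazin_invertible_def)
    note reg = regular[OF x(1,2)]
    show ?thesis
    proof (rule ex1I)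
      show "?P (a * x)" using reg x(3) by blast
    next
      fix f assume f: "?P f"
      \<comment> \<open>The double commutant is used here: a competitor \<open>f\<close> commutes
        with \<open>a\<close>, hence with \<open>x\<close>, so the idempotents \<open>a * x\<close>
        and \<open>f\<close> commute.\<close>
      have xf: "x * f = f * x" using comm2D[OF x(2)] f by blast
      have ef: "(a * x) * f = f * (a * x)" using commute_mult[OF _ xf] f by blast
      have "a ^ n * f = f * a ^ n" "a ^ n * (a * x) = (a * x) * a ^ n"
        using f reg by (simp_all add: power_commuting_commutes)
      then have "(a ^ n - f) * (a ^ n - a * x) = (a ^ n - a * x) * (a ^ n - f)"
        using ef by (simp add: left_diff_distrib right_diff_distrib)
      then have "(a ^ n - f) - (a ^ n - a * x) \<in> sqrt_jacobson"
        using sqrt_jacobson_diff f x(3) by blast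
      then have "a * x - f \<in> sqrt_jacobson" by simp
      then show "f = a * x" using commuting_idempotents_eq[of "a * x" f] reg f ef by simp
    qed
  qed

  have two_one: "pns_Drazin_invertible n a" if ex1: "\<exists>!e. ?P e"
  proof -
    obtain e where e: "?P e" and unique: "\<And>f. ?P f \<Longrightarrow> f = e" using ex1 by metis
    obtain y where y: "a * y = e" "y = y * a * y"
      "\<And>z. z * a = a * z \<Longrightarrow> z * e = e * z \<Longrightarrow> y * z = z * y"
      using spectral_inverse[OF n, of e a] e by metis
    \<comment> \<open>Uniqueness of \<open>e\<close> makes both corners of \<open>z\<close>
      vanish.\<close>
    have "z * e = e * z" if "z * a = a * z" for z
      using unique_spectral_idempotent_comm2[OF n, of e a z] e unique that by blast
    then have "y \<in> comm2 a" using y(3) by (simp add: comm2_def comm_def)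
    then show ?thesis using y e unfolding pns_Drazin_invertible_def by metis
  qed

  have two_iff_three: "(\<exists>!e. ?P e) \<longleftrightarrow> (\<exists>!y. ?Q y)"
  proof
    assume ex1: "\<exists>!e. ?P e"
    \<comment> \<open>\<open>y\<close> is recovered from \<open>a * y\<close>: if
      \<open>a * x = a * y\<close>, then \<open>x = x * (a * x) = x * (a * y) = (a * x) * y = (a *
      y) * y = y\<close>.\<close>
    have "x = y" if x: "?Q x" and y: "?Q y" for x y
    proof -
      have axy: "a * x = a * y" using ex1 QP[OF x] QP[OF y] by blast
      have "x = x * (a * x)" using x by (metis mult.assoc)
      also have "\<dots> = (a * x) * y" unfolding axy using x axy by (metis mult.assoc)
      also have "\<dots> = y" using y axy by (metis mult.assoc)
      finally show ?thesis .
    qed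
    then show "\<exists>!y. ?Q y" using ex1 PQ by blast
  next
    assume ex1: "\<exists>!y. ?Q y"
    then show "\<exists>!e. ?P e" using PQ QP by metis
  qed

  have one_four: "p_Drazin_invertible a \<and> a - a ^ (n + 1) \<in> sqrt_jacobson"
    if pns: "pns_Drazin_invertible n a"
  proof -
    obtain x where x: "x * a * x = x" "x \<in> comm2 a" and w: "a ^ n - a * x \<in> sqrt_jacobson"
      using pns by (auto simp: pns_Drazin_invertible_def)
    note reg = regular[OF x]
    \<comment> \<open>This element is \<open>a - a ^ 2 * x\<close>. Subtracting
      \<open>a * (a ^ n - a * x)\<close>, which commutes with it, leaves
      \<open>a - a ^ (n + 1)\<close>.\<close>
    have c: "a * (1 - a * x) \<in> sqrt_jacobson" by (rule spectral_complement[OF n reg(2,3) w])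
    have ane: "a ^ n * (a * x) = (a * x) * a ^ n" and ana: "a ^ n * a = a * a ^ n"
      using reg by (simp_all add: power_commuting_commutes)
    have wa: "a * (a ^ n - a * x) = (a ^ n - a * x) * a"
      using ana reg(3) by (simp add: left_diff_distrib right_diff_distrib)
    have wc: "(1 - a * x) * (a ^ n - a * x) = (a ^ n - a * x) * (1 - a * x)"
      using ane by (simp add: left_diff_distrib right_diff_distrib)
    have ac: "a * (1 - a * x) = (1 - a * x) * a"
      using reg(3) by (simp add: left_diff_distrib right_diff_distrib)
    have aw: "a * (a ^ n - a * x) \<in> sqrt_jacobson" using w wa by (rule sqrt_jacobson_mult_left)
    have "a * (1 - a * x) * (a ^ n - a * x) = (a ^ n - a * x) * (a * (1 - a * x))"
      using wa wc by (rule commute_mult)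
    moreover have "a * (1 - a * x) * a = a * (a * (1 - a * x))"
      using ac by (metis mult.assoc)
    ultimately have "a * (1 - a * x) * (a * (a ^ n - a * x)) = a * (a ^ n - a * x) * (a * (1 - a * x))"
      by (metis commute_mult)
    from sqrt_jacobson_diff[OF c aw this]
    have "a - a ^ (n + 1) \<in> sqrt_jacobson" by (simp add: algebra_simps)
    moreover have "a - a ^ 2 * x \<in> sqrt_jacobson"
      using c by (simp add: algebra_simps power2_eq_square)
    ultimately show ?thesis using x unfolding p_Drazin_invertible_def by blast
  qed

  have four_one: "pns_Drazin_invertible n a"
    if p: "p_Drazin_invertible a" and s: "a - a ^ (n + 1) \<in> sqrt_jacobson"
  proof -
    obtain x where x: "x * a * x = x" "x \<in> comm2 a" and c: "a - a ^ 2 * x \<in> sqrt_jacobson"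
      using p by (auto simp: p_Drazin_invertible_def)
    note reg = regular[OF x]
    have pow: "a ^ k * a = a * a ^ k" "a ^ k * x = x * a ^ k" for k
      using reg(1) by (simp_all add: power_commuting_commutes power_commutes)
    let ?b = "a - a ^ 2 * x" and ?d = "a - a ^ (n + 1)"
    have ba: "?b * a = a * ?b" and bx: "?b * x = x * ?b"
      using pow[of 2] reg(1) by (simp_all add: left_diff_distrib right_diff_distrib) (metis mult.assoc)+
    have da: "?d * a = a * ?d" and dx: "?d * x = x * ?d"
      using pow[of "n + 1"] reg(1) by (simp_all add: left_diff_distrib right_diff_distrib del: power_Suc)
    have ban: "a ^ k * ?b = ?b * a ^ k" for k
      using ba by (simp add: power_commuting_commutes)
    have db: "?d * ?b = ?b * ?d"
      using ba[symmetric] ban by (rule commute_diff)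
    \<comment> \<open>The aim is \<open>a ^ n - a * x = a ^ (n - 1) * ?b - x * ?d\<close>, a
      difference of commuting elements nilpotent modulo the radical.\<close>
    have 1: "a ^ (n - 1) * ?b \<in> sqrt_jacobson" using c ban by (rule sqrt_jacobson_mult_left)
    have 2: "x * ?d \<in> sqrt_jacobson" using s dx[symmetric] by (rule sqrt_jacobson_mult_left)
    have "a ^ (n - 1) * ?b * (x * ?d) = x * ?d * (a ^ (n - 1) * ?b)"
    proof -
      have "a ^ (n - 1) * ?d = ?d * a ^ (n - 1)"
        using da by (simp add: power_commuting_commutes)
      then have "x * ?d * a ^ (n - 1) = a ^ (n - 1) * (x * ?d)"
        using commute_mult[OF pow(2)[symmetric]] by metis
      moreover have "x * ?d * ?b = ?b * (x * ?d)" using bx[symmetric] db by (rule commute_mult)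
      ultimately show ?thesis by (intro commute_mult) (rule sym, assumption)+
    qed
    from sqrt_jacobson_diff[OF 1 2 this]
    have "a ^ (n - 1) * ?b - x * ?d \<in> sqrt_jacobson" .
    moreover have "a ^ (n - 1) * ?b - x * ?d = a ^ n - a * x"
    proof -
      obtain m where m: "n = Suc m" using n by (cases n) auto
      \<comment> \<open>With \<open>m = n - 1\<close>, these are the two terms of degree
        \<open>n + 1\<close> in \<open>a\<close>; they cancel in the difference.\<close>
      have "a ^ m * a ^ 2 * x = x * a ^ (n + 1)"
        unfolding power_add[symmetric] pow(2) m by (simp add: numeral_2_eq_2)
      then show ?thesis
        using m reg(1) pow(1)[of m]
        by (simp add: right_diff_distrib mult.assoc)
    qed
    ultimately show ?thesis using x unfolding pns_Drazin_invertible_def by auto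
  qed

  show ?thesis
    unfolding P_iff using one_two two_one two_iff_three one_four four_one by blast
qed

end
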